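(* Let $G=K_{n_1,n_2,\ldots,n_t}$ be a complete $t$-partite graph such that $3\leq n_1\leq n_2\leq\cdots\leq n_t$, and let $n=n_1+n_2+\cdots+n_t$. Let $\Gamma$ be an Abelian group of order $n$ having more than three involutions. If $n_t\geq 3n/4-1$, then $G$ is $\Gamma$-distance magic.
   Context: Groups are written additively with identity $0$; an involution is an element $\iota\in\Gamma$ of order $2$ (i.e. $\iota\neq 0$, $2\iota=0$). For a simple graph $G=(V,E)$ with $|V|=n$ and an Abelian group $\Gamma$ of order $n$, a $\Gamma$-distance magic labeling of $G$ is a bijection $\ell:V\to\Gamma$ for which there is an element $\mu\in\Gamma$ (the magic constant) such that $\sum_{y\in N(x)}\ell(y)=\mu$ for every $x\in V$, where $N(x)$ is the set of vertices adjacent to $x$. The graph $G$ is $\Gamma$-distance magic if it admits a $\Gamma$-distance magic labeling. $K_{n_1,\ldots,n_t}$ is the complete multipartite graph with vertex classes of sizes $n_1,\ldots,n_t$. *)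

theory Defs
  imports "HOL-Algebra.Algebra" "Graph_Theory.Graph_Theory"
begin

text \<open>Simple graphs are symmetric, loop-free pair digraphs (locale \<^locale>\<open>pair_graph\<close>).\<close>

definition nbrs :: "'v pair_pre_digraph \<Rightarrow> 'v \<Rightarrow> 'v set" where
  "nbrs G x = {y \<in> pverts G. (x, y) \<in> parcs G}"

text \<open>
  Abelian groups are \<^locale>\<open>comm_group\<close>s, hence written multiplicatively: the sum of the
  labels of the neighbours is a \<^const>\<open>finprod\<close>.
\<close>

definition distance_magic_labeling ::
  "('g, 'm) monoid_scheme \<Rightarrow> 'v pair_pre_digraph \<Rightarrow> ('v \<Rightarrow> 'g) \<Rightarrow> bool" where
  "distance_magic_labeling \<Gamma> G l \<longleftrightarrow>
     bij_betw l (pverts G) (carrier \<Gamma>) \<and>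
     (\<exists>\<mu> \<in> carrier \<Gamma>. \<forall>x \<in> pverts G. finprod \<Gamma> l (nbrs G x) = \<mu>)"

definition distance_magic ::
  "('g, 'm) monoid_scheme \<Rightarrow> 'v pair_pre_digraph \<Rightarrow> bool" where
  "distance_magic \<Gamma> G \<longleftrightarrow> (\<exists>l. distance_magic_labeling \<Gamma> G l)"

definition involutions :: "('g, 'm) monoid_scheme \<Rightarrow> 'g set" where
  "involutions \<Gamma> = {x \<in> carrier \<Gamma>. group.ord \<Gamma> x = 2}"

lemma (in group) involutions_iff:
  "x \<in> involutions G \<longleftrightarrow> x \<in> carrier G \<and> x \<noteq> \<one> \<and> x \<otimes> x = \<one>"
proof (cases "x \<in> carrier G")
  case True
  have "ord x = 2 \<longleftrightarrow> x \<noteq> \<one> \<and> x \<otimes> x = \<one>"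
  proof
    assume *: "ord x = 2"
    have "x \<otimes> x = x [^] (2::nat)"
      using True by (simp add: numeral_2_eq_2)
    with * pow_ord_eq_1[OF True] ord_eq_1[OF True] show "x \<noteq> \<one> \<and> x \<otimes> x = \<one>"
      by auto
  next
    assume *: "x \<noteq> \<one> \<and> x \<otimes> x = \<one>"
    then have "x [^] (2::nat) = \<one>"
      using True by (simp add: numeral_2_eq_2)
    then have "ord x dvd 2"
      using pow_eq_id[OF True] by simp
    moreover have "ord x \<noteq> 1"
      using * ord_eq_1[OF True] by simp
    ultimately show "ord x = 2"
      using two_is_prime_nat by (auto simp: prime_nat_iff)
  qed
  with True show ?thesis by (simp add: involutions_def)
qed (simp add: involutions_def)

text \<open>
  \<open>complete_multipartite ns G\<close> says that \<open>G\<close> is (a copy of) \<open>K\<^bsub>n\<^sub>1,\<dots>,n\<^sub>t\<^esub>\<close>, where \<open>ns\<close> is the list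
  \<open>n\<^sub>1, \<dots>, n\<^sub>t\<close>; the classes \<open>V\<close> are indexed from \<open>0\<close>.
\<close>

definition complete_multipartite :: "nat list \<Rightarrow> 'v pair_pre_digraph \<Rightarrow> bool" where
  "complete_multipartite ns G \<longleftrightarrow>
     (\<exists>V :: nat \<Rightarrow> 'v set.
        (\<forall>i < length ns. finite (V i) \<and> card (V i) = ns ! i) \<and>
        disjoint_family_on V {..<length ns} \<and>
        pverts G = (\<Union>i<length ns. V i) \<and>
        parcs G = {(u, v). \<exists>i < length ns. \<exists>j < length ns. i \<noteq> j \<and> u \<in> V i \<and> v \<in> V j})"

lemma complete_multipartite_imp_pair_graph:
  assumes "complete_multipartite ns G"
  shows "pair_graph G"
proof -
  obtain V where fin: "\<forall>i < length ns. finite (V i) \<and> card (V i) = ns ! i"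
    and disj: "disjoint_family_on V {..<length ns}"
    and verts: "pverts G = (\<Union>i<length ns. V i)"
    and arcs: "parcs G =
      {(u, v). \<exists>i < length ns. \<exists>j < length ns. i \<noteq> j \<and> u \<in> V i \<and> v \<in> V j}"
    using assms unfolding complete_multipartite_def by (elim exE conjE)
  have finV: "finite (pverts G)"
    using fin by (simp add: verts)
  have sub: "parcs G \<subseteq> pverts G \<times> pverts G"
    by (auto simp: verts arcs)
  have noloop: "fst e \<noteq> snd e" if "e \<in> parcs G" for e
  proof -
    obtain i j where "i < length ns" "j < length ns" "i \<noteq> j" "fst e \<in> V i" "snd e \<in> V j"
      using \<open>e \<in> parcs G\<close> unfolding arcs by auto
    with disjoint_family_onD[OF disj, of i j] show ?thesis
      by auto
  qed
  have "sym (parcs G)"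
    unfolding sym_def arcs by blast
  moreover have "finite (parcs G)"
    using finite_subset[OF sub] finV by simp
  ultimately show ?thesis
    using finV sub noloop by unfold_locales (auto simp: symmetric_def)
qed

end

theory Submission
  imports Defs
begin

text \<open>
  Summing the labels outside a vertex class shows that it suffices to partition \<open>\<Gamma>\<close> into
  zero-sum sets of the prescribed sizes. As \<open>\<Gamma>\<close> has two involutions, all its elements sum to
  zero, so the largest set may be taken to be the complement of the others. The others are chosen
  greedily: they occupy at most \<open>n/4 + 1\<close> elements, so that all but three elements of the current
  set can be taken arbitrarily, and a count of pairs \<open>(a, b)\<close> shows that the last three can be
  chosen with any prescribed sum.
\<close>

section \<open>The product of all group elements\<close>

text \<open>The partition is encoded by the map \<open>B\<close> from an element to its block, so
  that only single blocks have to be evaluated later. Different blocks are disjoint because a common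
  element \<open>z\<close> gives \<open>B x = B z = B y\<close>.\<close>

lemma (in comm_group) finprod_partition_one:
  assumes "finite (carrier G)"
    and cover: "\<And>x. x \<in> carrier G \<Longrightarrow> x \<in> B x \<and> B x \<subseteq> carrier G"
    and block: "\<And>x y. x \<in> carrier G \<Longrightarrow> y \<in> B x \<Longrightarrow> B y = B x"
    and one: "\<And>x. x \<in> carrier G \<Longrightarrow> finprod G (\<lambda>y. y) (B x) = \<one>"
  shows "finprod G (\<lambda>y. y) (carrier G) = \<one>"
proof -
  have fin: "finite (B x)" if "x \<in> carrier G" for x
    using cover[OF that] assms(1) finite_subset by blast
  have disj: "pairwise disjnt (B ` carrier G)"
  proof (clarsimp simp: pairwise_def disjnt_iff)
    fix x y z
    assume "x \<in> carrier G" "y \<in> carrier G" "B x \<noteq> B y" "z \<in> B x" "z \<in> B y"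
    then show False using block by metis
  qed
  have "carrier G = \<Union> (B ` carrier G)"
    using cover by blast
  then have "finprod G (\<lambda>y. y) (carrier G) = finprod G (\<lambda>y. y) (\<Union> (B ` carrier G))"
    by simp
  also have "\<dots> = finprod G (finprod G (\<lambda>y. y)) (B ` carrier G)"
    using assms(1) fin cover by (intro finprod_Union_disjoint[OF _ _ disj]) auto
  also have "\<dots> = \<one>"
    by (rule finprod_one_eqI) (use one in auto)
  finally show ?thesis .
qed

text \<open>The elements squaring to \<one> form a subgroup \<open>T\<close> containing the Klein
  four-group generated by \<open>a\<close> and \<open>b\<close>. Each coset \<open>x\<close> times
  that four-group inside \<open>T\<close> has product x^4 a^2 b^2 = \<one>. An element outside
  \<open>T\<close> differs from its inverse and cancels against it.\<close>

lemma (in comm_group) finprod_carrier_eq_one: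
  assumes fin: "finite (carrier G)"
    and a: "a \<in> involutions G" and b: "b \<in> involutions G" and "a \<noteq> b"
  shows "finprod G (\<lambda>y. y) (carrier G) = \<one>"
proof -
  have [simp]: "a \<in> carrier G" "a \<noteq> \<one>" "a \<otimes> a = \<one>" "b \<in> carrier G" "b \<noteq> \<one>" "b \<otimes> b = \<one>"
    using a b by (auto simp: involutions_iff)
  have [simp]: "a \<otimes> (a \<otimes> z) = z" "b \<otimes> (b \<otimes> z) = z" if "z \<in> carrier G" for z
    using that by (simp_all flip: m_assoc)
  have ab [simp]: "a \<otimes> b \<noteq> \<one>"
    using \<open>a \<noteq> b\<close> by (metis \<open>a \<in> carrier G\<close> \<open>a \<otimes> a = \<one>\<close> \<open>b \<in> carrier G\<close> l_cancel)
  define T where "T = {x \<in> carrier G. x \<otimes> x = \<one>}"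
  have sq: "(x \<otimes> y) \<otimes> (x \<otimes> y) = (x \<otimes> x) \<otimes> (y \<otimes> y)" if "x \<in> carrier G" "y \<in> carrier G" for x y
    using that by (simp add: m_ac)
  define B where "B x = (if x \<in> T then {x, x \<otimes> a, x \<otimes> b, x \<otimes> (a \<otimes> b)} else {x, inv x})" for x
  show ?thesis
  proof (rule finprod_partition_one[OF fin, of B])
    fix x assume x: "x \<in> carrier G"
    then show "x \<in> B x \<and> B x \<subseteq> carrier G"
      by (auto simp: B_def)
    \<comment> \<open>A block lies entirely inside \<open>T\<close> or entirely outside it, so
      \<open>B y\<close> and \<open>B x\<close> are given by the same branch of the
      definition.\<close>
    show "B y = B x" if "y \<in> B x" for y
    proof (cases "x \<in> T")
      case True
      have "x \<otimes> z \<in> T" if "z \<in> {a, b, a \<otimes> b}" for z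
        using True x that sq[of x z] sq[of a b] by (auto simp: T_def)
      with True that have "y \<in> T"
        by (auto simp: B_def)
      then show ?thesis
        using True that x by (auto simp: B_def m_ac)
    next
      case False
      have "inv x \<notin> T"
        using False x by (auto simp: T_def simp flip: inv_mult)
      then show ?thesis
        using False that x by (auto simp: B_def)
    qed
    show "finprod G (\<lambda>y. y) (B x) = \<one>"
    proof (cases "x \<in> T")
      case True
      have ne: "x \<noteq> x \<otimes> a" "x \<noteq> x \<otimes> b" "x \<noteq> x \<otimes> (a \<otimes> b)" "x \<otimes> a \<noteq> x \<otimes> b"
        "x \<otimes> a \<noteq> x \<otimes> (a \<otimes> b)" "x \<otimes> b \<noteq> x \<otimes> (a \<otimes> b)"
        using x \<open>a \<noteq> b\<close> by auto
      have "finprod G (\<lambda>y. y) (B x) = x \<otimes> (x \<otimes> a \<otimes> (x \<otimes> b \<otimes> (x \<otimes> (a \<otimes> b))))"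
        using True x ne by (simp add: B_def)
      also have "\<dots> = (x \<otimes> x) \<otimes> (x \<otimes> x) \<otimes> ((a \<otimes> a) \<otimes> (b \<otimes> b))"
        using x by (simp only: m_ac m_closed \<open>a \<in> carrier G\<close> \<open>b \<in> carrier G\<close>)
      also have "\<dots> = \<one>"
        using True by (simp add: T_def)
      finally show ?thesis .
    next
      case False
      then have "x \<noteq> inv x"
        using x by (metis (mono_tags, lifting) T_def mem_Collect_eq r_inv)
      then show ?thesis
        using False x by (simp add: B_def)
    qed
  qed
qed

section \<open>Greedy choice of disjoint sets with product one\<close>

text \<open>A pair \<open>(a, b)\<close> determines \<open>c\<close>. The pair fails only if one of
  the three elements lies in \<open>S\<close>, which each time accounts for at most
  \<open>card S * order G\<close> pairs, or if two of them coincide, which each time accounts for at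
  most \<open>order G\<close> pairs. Hence fewer than \<open>order G * order G\<close> pairs
  fail.\<close>

lemma (in comm_group) exists_triple_with_product:
  assumes fin: "finite (carrier G)"
    and S: "S \<subseteq> carrier G" "3 * card S + 3 < order G" and g: "g \<in> carrier G"
  shows "\<exists>a b c. {a, b, c} \<subseteq> carrier G - S \<and> a \<noteq> b \<and> a \<noteq> c \<and> b \<noteq> c \<and> a \<otimes> (b \<otimes> c) = g"
proof (rule ccontr)
  assume none: "\<not> ?thesis"
  let ?C = "carrier G"
  have finS: "finite S" using S fin finite_subset by blast
  \<comment> \<open>In order, the six sets cover the failures \<open>a \<in> S\<close>,
    \<open>b \<in> S\<close>, \<open>c \<in> S\<close>, \<open>a = b\<close>, \<open>a = c\<close>
    and \<open>b = c\<close>. Writing the last four as images bounds their sizes by those of the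
    parameter sets.\<close>
  define Bad where "Bad = S \<times> ?C \<union> ?C \<times> S
    \<union> (\<lambda>(x, s). (x, g \<otimes> inv (x \<otimes> s))) ` (?C \<times> S)
    \<union> (\<lambda>x. (x, x)) ` ?C \<union> (\<lambda>x. (x, g \<otimes> inv (x \<otimes> x))) ` ?C \<union> (\<lambda>x. (g \<otimes> inv (x \<otimes> x), x)) ` ?C"
  have solve: "x = g \<otimes> inv (y \<otimes> z)" if "x \<in> ?C" "y \<in> ?C" "z \<in> ?C" "x \<otimes> (y \<otimes> z) = g" for x y z
    using that g inv_solve_right[of x g "y \<otimes> z"] by simp
  have "?C \<times> ?C \<subseteq> Bad"
  proof clarify
    fix a b assume ab: "a \<in> ?C" "b \<in> ?C"
    define c where "c = g \<otimes> inv (a \<otimes> b)"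
    have c: "c \<in> ?C" using ab g by (simp add: c_def)
    have "c \<otimes> (a \<otimes> b) = g"
      using ab g by (simp add: c_def m_assoc)
    \<comment> \<open>Solving the first form for \<open>a\<close> handles \<open>b = c\<close>;
      solving the second for \<open>b\<close> handles \<open>c \<in> S\<close> and
      \<open>a = c\<close>.\<close>
    then have abc: "a \<otimes> (b \<otimes> c) = g" "b \<otimes> (a \<otimes> c) = g"
      using ab c by (simp_all add: m_ac)
    with none ab c consider "a \<in> S" | "b \<in> S" | "c \<in> S" | "a = b" | "a = c" | "b = c"
      by blast
    then show "(a, b) \<in> Bad"
    proof cases
      case 3
      then have "(a, b) \<in> (\<lambda>(x, s). (x, g \<otimes> inv (x \<otimes> s))) ` (?C \<times> S)"
        using ab solve[OF ab(2,1) c abc(2)] by force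
      then show ?thesis by (simp add: Bad_def)
    next
      case 5
      then show ?thesis using ab solve[OF ab(2,1) c abc(2)] by (auto simp: Bad_def)
    next
      case 6
      then show ?thesis using ab solve[OF ab c abc(1)] by (auto simp: Bad_def)
    qed (use ab in \<open>auto simp: Bad_def\<close>)
  qed
  moreover have "finite Bad"
    using fin finS by (simp add: Bad_def)
  ultimately have "card (?C \<times> ?C) \<le> card Bad"
    by (rule card_mono[rotated])
  also have "\<dots> \<le> card (S \<times> ?C) + card (?C \<times> S) + card (?C \<times> S) + card ?C + card ?C + card ?C"
    unfolding Bad_def
    by (intro card_Un_le[THEN order_trans] add_mono card_image_le finite_cartesian_product fin finS
        order_refl)
  also have "\<dots> = (3 * card S + 3) * order G"
    by (simp add: card_cartesian_product order_def algebra_simps)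
  also have "\<dots> < order G * order G"
    using S(2) by simp
  finally show False
    by (simp add: card_cartesian_product order_def)
qed

text \<open>All but three elements are taken arbitrarily as \<open>R\<close>; a triple avoiding
  \<open>S \<union> R\<close> is then chosen with product inverse to that of
  \<open>R\<close>.\<close>

lemma (in comm_group) exists_subset_product_one:
  assumes fin: "finite (carrier G)"
    and S: "S \<subseteq> carrier G" and k: "3 \<le> k" "4 * (card S + k) \<le> order G + 4"
  shows "\<exists>A \<subseteq> carrier G - S. card A = k \<and> finprod G (\<lambda>y. y) A = \<one>"
proof -
  have finS: "finite S" using S fin finite_subset by blast
  have "k - 3 \<le> card (carrier G - S)"
    using k S finS by (simp add: card_Diff_subset order_def)
  then obtain R where R: "R \<subseteq> carrier G - S" "card R = k - 3" "finite R"
    by (rule obtain_subset_with_card_n)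
  let ?r = "finprod G (\<lambda>y. y) R"
  have r: "?r \<in> carrier G"
    using R by (intro finprod_closed) auto
  have "card (S \<union> R) + 3 = card S + k"
    using R finS k by (subst card_Un_disjoint) auto
  then have "4 * (card (S \<union> R) + 3) \<le> order G + 4"
    using k by metis
  \<comment> \<open>The previous bound amounts to
    \<open>4 * card (S \<union> R) + 8 \<le> order G\<close>; the three elements still to be chosen
    provide the slack.\<close>
  then have "3 * card (S \<union> R) + 3 < order G"
    by (simp add: add.commute)
  then obtain a b c where abc: "{a, b, c} \<subseteq> carrier G - (S \<union> R)" "a \<noteq> b" "a \<noteq> c" "b \<noteq> c"
    and prod: "a \<otimes> (b \<otimes> c) = inv ?r"
    using exists_triple_with_product[OF fin, of "S \<union> R" "inv ?r"] R S r by auto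
  have "finprod G (\<lambda>y. y) (R \<union> {a, b, c}) = ?r \<otimes> finprod G (\<lambda>y. y) {a, b, c}"
    using R abc by (intro finprod_Un_disjoint) auto
  also have "finprod G (\<lambda>y. y) {a, b, c} = inv ?r"
    using abc by (simp flip: prod)
  finally have "finprod G (\<lambda>y. y) (R \<union> {a, b, c}) = \<one>"
    using r by simp
  moreover have "card (R \<union> {a, b, c}) = k"
    using R abc k by (subst card_Un_disjoint) auto
  ultimately show ?thesis
    using R abc by (intro exI[of _ "R \<union> {a, b, c}"]) auto
qed

text \<open>\<open>S\<close> collects the elements already used. The size bound is preserved by the
  induction, since choosing a set of size \<open>k\<close> moves \<open>k\<close> from
  \<open>sum_list ks\<close> to \<open>card S\<close>.\<close>

lemma (in comm_group) exists_disjoint_product_one: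
  assumes fin: "finite (carrier G)"
    and "S \<subseteq> carrier G" "\<forall>k \<in> set ks. 3 \<le> k" "4 * (card S + sum_list ks) \<le> order G + 4"
  shows "\<exists>A. (\<forall>i < length ks. A i \<subseteq> carrier G - S \<and> card (A i) = ks ! i
                \<and> finprod G (\<lambda>y. y) (A i) = \<one>)
             \<and> disjoint_family_on A {..<length ks}"
  using assms(2-)
proof (induction ks arbitrary: S)
  case Nil
  then show ?case by (simp add: disjoint_family_on_def)
next
  case (Cons k ks)
  obtain A0 where A0: "A0 \<subseteq> carrier G - S" "card A0 = k" "finprod G (\<lambda>y. y) A0 = \<one>"
    using exists_subset_product_one[OF fin Cons.prems(1), of k] Cons.prems by auto
  have "finite S" "finite A0"
    using A0 Cons.prems(1) fin by (auto intro: finite_subset)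
  then have "card (S \<union> A0) = card S + k"
    using A0 by (subst card_Un_disjoint) auto
  then have "4 * (card (S \<union> A0) + sum_list ks) \<le> order G + 4"
    using Cons.prems(3) by simp
  moreover have "S \<union> A0 \<subseteq> carrier G"
    using Cons.prems(1) A0 by auto
  ultimately obtain A where A: "\<And>i. i < length ks \<Longrightarrow> A i \<subseteq> carrier G - (S \<union> A0) \<and> card (A i) = ks ! i
        \<and> finprod G (\<lambda>y. y) (A i) = \<one>"
      and disj: "disjoint_family_on A {..<length ks}"
    using Cons.IH[of "S \<union> A0"] Cons.prems(2) by auto
  \<comment> \<open>The new set gets index 0 and the indices of the remaining family shift by
    one.\<close>
  let ?A = "case_nat A0 A"
  have sub: "?A i \<subseteq> carrier G - S \<and> card (?A i) = (k # ks) ! i \<and> finprod G (\<lambda>y. y) (?A i) = \<one>"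
    if "i < length (k # ks)" for i
  proof (cases i)
    case (Suc j)
    then show ?thesis using A[of j] that by auto
  qed (use A0 in simp)
  have away: "A0 \<inter> A j = {}" if "j < length ks" for j
    using A[OF that] by blast
  have "?A i \<inter> ?A j = {}"
    if "i < length (k # ks)" "j < length (k # ks)" "i \<noteq> j" for i j
    using that away disjoint_family_onD[OF disj]
    by (cases i; cases j) (simp_all add: Int_commute)
  then have "disjoint_family_on ?A {..<length (k # ks)}"
    by (simp add: disjoint_family_on_def)
  with sub show ?case by blast
qed

text \<open>The complement of the greedily chosen sets has size \<open>m\<close> by subtraction, and
  its product is \<one> because both the full product and the product over the chosen sets
  are.\<close>

lemma (in comm_group) exists_partition_product_one:
  assumes fin: "finite (carrier G)"
    and one: "finprod G (\<lambda>y. y) (carrier G) = \<one>"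
    and ks: "\<forall>k \<in> set ks. 3 \<le> k" "4 * sum_list ks \<le> order G + 4"
    and m: "order G = sum_list ks + m"
  shows "\<exists>A. (\<forall>i < length (ks @ [m]). card (A i) = (ks @ [m]) ! i \<and> finprod G (\<lambda>y. y) (A i) = \<one>)
             \<and> disjoint_family_on A {..<length (ks @ [m])}
             \<and> (\<Union>i<length (ks @ [m]). A i) = carrier G"
proof -
  let ?t = "length ks"
  obtain A where A: "\<And>i. i < ?t \<Longrightarrow> A i \<subseteq> carrier G \<and> card (A i) = ks ! i
        \<and> finprod G (\<lambda>y. y) (A i) = \<one>"
      and disj: "disjoint_family_on A {..<?t}"
    using exists_disjoint_product_one[OF fin, of "{}" ks] ks by auto
  let ?U = "\<Union>i<?t. A i"
  have sub: "?U \<subseteq> carrier G" and finA: "\<And>i. i < ?t \<Longrightarrow> finite (A i)" and finU: "finite ?U"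
    using A finite_subset[OF _ fin] by auto
  have "card ?U = (\<Sum>i<?t. card (A i))"
    using finA disjoint_family_onD[OF disj] by (intro card_UN_disjoint) auto
  also have "\<dots> = sum_list ks"
    using A by (simp add: sum_list_sum_nth atLeast0LessThan)
  finally have cardU: "card (carrier G - ?U) = m"
    using m finU sub by (simp add: card_Diff_subset order_def)
  have "finprod G (\<lambda>y. y) ?U = finprod G (\<lambda>i. finprod G (\<lambda>y. y) (A i)) {..<?t}"
    using A finA disj
    by (intro finprod_UN_disjoint) (auto simp: pairwise_def disjnt_def disjoint_family_on_def)
  also have "\<dots> = \<one>"
    by (rule finprod_one_eqI) (use A in simp)
  finally have "finprod G (\<lambda>y. y) ?U = \<one>" .
  moreover have "finprod G (\<lambda>y. y) (?U \<union> (carrier G - ?U)) =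
      finprod G (\<lambda>y. y) ?U \<otimes> finprod G (\<lambda>y. y) (carrier G - ?U)"
    using fin finU sub by (intro finprod_Un_disjoint) auto
  moreover have "?U \<union> (carrier G - ?U) = carrier G"
    using sub by auto
  moreover have "finprod G (\<lambda>y. y) (carrier G - ?U) \<in> carrier G"
    by (intro finprod_closed) auto
  ultimately have rest: "finprod G (\<lambda>y. y) (carrier G - ?U) = \<one>"
    using one by simp
  let ?A = "A(?t := carrier G - ?U)"
  have "card (?A i) = (ks @ [m]) ! i \<and> finprod G (\<lambda>y. y) (?A i) = \<one>" if "i < Suc ?t" for i
    using that A[of i] cardU rest by (cases "i = ?t") (auto simp: nth_append)
  moreover have "disjoint_family_on ?A {..<Suc ?t}"
    using disj unfolding disjoint_family_on_def lessThan_Suc by fastforce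
  moreover have "(\<Union>i<Suc ?t. ?A i) = carrier G"
  proof -
    have "(\<Union>i<Suc ?t. ?A i) = ?U \<union> (carrier G - ?U)"
      by (auto simp: lessThan_Suc)
    then show ?thesis using sub by auto
  qed
  ultimately show ?thesis
    by (intro exI[of _ ?A]) simp
qed

section \<open>From partitions of the group to labelings\<close>

lemma bij_betw_UN_disjoint_families:
  assumes V: "disjoint_family_on V I" and A: "disjoint_family_on A I"
    and fin: "\<And>i. i \<in> I \<Longrightarrow> finite (V i) \<and> finite (A i) \<and> card (V i) = card (A i)"
  shows "\<exists>l. bij_betw l (\<Union>i\<in>I. V i) (\<Union>i\<in>I. A i) \<and> (\<forall>i\<in>I. l ` V i = A i)"
proof -
  have "\<forall>i\<in>I. \<exists>h. bij_betw h (V i) (A i)"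
    using fin finite_same_card_bij by blast
  then obtain h where h: "\<And>i. i \<in> I \<Longrightarrow> bij_betw (h i) (V i) (A i)"
    by metis
  \<comment> \<open>Disjointness of \<open>V\<close> makes the index unique, so \<open>l\<close>
    agrees with \<open>h i\<close> on \<open>V i\<close>. Disjointness of \<open>A\<close> will make
    the glued map injective.\<close>
  define l where "l x = h (THE i. i \<in> I \<and> x \<in> V i) x" for x
  have l: "l x = h i x" if "i \<in> I" "x \<in> V i" for i x
  proof -
    have "(THE i. i \<in> I \<and> x \<in> V i) = i"
      using that disjoint_family_onD[OF V] by blast
    then show ?thesis by (simp add: l_def)
  qed
  have bij: "bij_betw l (V i) (A i)" if "i \<in> I" for i
    using h[OF that] l[OF that] by (simp cong: bij_betw_cong)
  have image: "l ` V i = A i" if "i \<in> I" for i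
    using bij[OF that] by (rule bij_betw_imp_surj_on)
  have "inj_on l (\<Union>i\<in>I. V i)"
  proof (rule inj_onI, clarify)
    fix x y i j
    assume *: "l x = l y" "i \<in> I" "x \<in> V i" "j \<in> I" "y \<in> V j"
    then have "l x \<in> A i \<inter> A j"
      using image by (metis IntI imageI)
    then have "i = j"
      using disjoint_family_onD[OF A, of i j] * by auto
    then show "x = y"
      using * bij[of i] by (auto simp: bij_betw_def dest: inj_onD)
  qed
  moreover have "l ` (\<Union>i\<in>I. V i) = (\<Union>i\<in>I. A i)"
    using image by (simp add: image_UN)
  ultimately show ?thesis
    using image unfolding bij_betw_def by blast
qed

text \<open>The neighbours of a vertex are exactly the vertices outside its class, so their labels
  fill the complement of some \<open>A i\<close>. The magic constant is therefore \<one>.\<close>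

lemma (in comm_group) distance_magic_if_partition_product_one:
  assumes fin: "finite (carrier G)"
    and one: "finprod G (\<lambda>y. y) (carrier G) = \<one>"
    and H: "complete_multipartite ns H"
    and A: "\<And>i. i < length ns \<Longrightarrow> card (A i) = ns ! i \<and> finprod G (\<lambda>y. y) (A i) = \<one>"
    and disjA: "disjoint_family_on A {..<length ns}"
    and cover: "(\<Union>i<length ns. A i) = carrier G"
  shows "distance_magic G H"
proof -
  obtain V where V: "\<forall>i < length ns. finite (V i) \<and> card (V i) = ns ! i"
    and disjV: "disjoint_family_on V {..<length ns}"
    and verts: "pverts H = (\<Union>i<length ns. V i)"
    and arcs: "parcs H =
      {(u, v). \<exists>i < length ns. \<exists>j < length ns. i \<noteq> j \<and> u \<in> V i \<and> v \<in> V j}"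
    using H unfolding complete_multipartite_def by (elim exE conjE)
  have sub: "A i \<subseteq> carrier G" if "i < length ns" for i
    using cover that by auto
  obtain l where l: "bij_betw l (pverts H) (carrier G)"
    and image: "\<And>i. i < length ns \<Longrightarrow> l ` V i = A i"
    using bij_betw_UN_disjoint_families[OF disjV disjA] V A finite_subset[OF sub fin]
    unfolding verts cover by auto
  have "finprod G l (nbrs H x) = \<one>" if "x \<in> pverts H" for x
  proof -
    obtain i where i: "i < length ns" "x \<in> V i"
      using \<open>x \<in> pverts H\<close> verts by auto
    have uniq: "j = i" if "j < length ns" "y \<in> V i" "y \<in> V j" for j y
      using disjoint_family_onD[OF disjV, of i j] i that by auto
    have nbrs: "nbrs H x = pverts H - V i"
      unfolding nbrs_def arcs verts using i uniq by blast
    have inj: "inj_on l (pverts H - V i)"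
      using l by (auto simp: bij_betw_def intro: inj_on_subset)
    have "l ` (pverts H - V i) = l ` pverts H - l ` V i"
      using l i verts by (intro inj_on_image_set_diff[of _ "pverts H"]) (auto simp: bij_betw_def)
    also have "\<dots> = carrier G - A i"
      using l image i by (simp add: bij_betw_def)
    finally have img: "l ` (pverts H - V i) = carrier G - A i" .
    have "finprod G l (nbrs H x) = finprod G (\<lambda>y. y) (carrier G - A i)"
      using finprod_reindex[of "\<lambda>y. y", OF _ inj] unfolding nbrs img by auto
    \<comment> \<open>The inserted factor is \<one>; it completes the product to one over the whole
      group.\<close>
    also have "\<dots> = finprod G (\<lambda>y. y) (A i) \<otimes> finprod G (\<lambda>y. y) (carrier G - A i)"
      using A[OF i(1)] by (simp add: finprod_closed)
    also have "\<dots> = finprod G (\<lambda>y. y) (A i \<union> (carrier G - A i))"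
      using sub[OF i(1)] fin finite_subset by (intro finprod_Un_disjoint[symmetric]) auto
    also have "A i \<union> (carrier G - A i) = carrier G"
      using sub[OF i(1)] by auto
    finally show ?thesis using one by simp
  qed
  then show ?thesis
    using l unfolding distance_magic_def distance_magic_labeling_def by blast
qed

theorem mainTheorem5:
  fixes G :: "'v pair_pre_digraph"
    and \<Gamma> :: "('g, 'm) monoid_scheme"
    and ns :: "nat list"
    and n :: nat
  assumes "ns \<noteq> []"
    and "sorted ns"
    and "3 \<le> ns ! 0"
    and "n = sum_list ns"
    and "complete_multipartite ns G"
    and "comm_group \<Gamma>"
    and "finite (carrier \<Gamma>)"
    and "order \<Gamma> = n"
    and "card (involutions \<Gamma>) > 3"
    and "real (last ns) \<ge> 3 * real n / 4 - 1"
  shows "distance_magic \<Gamma> G"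
proof -
  interpret comm_group \<Gamma> by fact
  obtain ks m where ns: "ns = ks @ [m]"
    using \<open>ns \<noteq> []\<close> by (metis append_butlast_last_id)
  have "3 \<le> k" if "k \<in> set ns" for k
  proof -
    obtain i where "i < length ns" "k = ns ! i"
      using \<open>k \<in> set ns\<close> by (metis in_set_conv_nth)
    with sorted_nth_mono[OF \<open>sorted ns\<close>, of 0 i] \<open>3 \<le> ns ! 0\<close> show ?thesis by simp
  qed
  then have ks: "\<forall>k \<in> set ks. 3 \<le> k"
    by (simp add: ns)
  have ord: "order \<Gamma> = sum_list ks + m"
    using assms by (simp add: ns)
  \<comment> \<open>With \<open>sum_list ks = n - m\<close>, this is the hypothesis
    \<open>m \<ge> 3 * n / 4 - 1\<close> multiplied by 4 and rearranged.\<close>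
  have "4 * sum_list ks \<le> order \<Gamma> + 4"
    using assms(4,8,10) by (simp add: ns field_simps)
  moreover have one: "finprod \<Gamma> (\<lambda>y. y) (carrier \<Gamma>) = \<one>\<^bsub>\<Gamma>\<^esub>"
  proof -
    \<comment> \<open>An infinite set has \<open>card\<close> 0, so the cardinality hypothesis also
      yields the finiteness required by \<open>card_le_Suc0_iff_eq\<close>.\<close>
    have "\<exists>a \<in> involutions \<Gamma>. \<exists>b \<in> involutions \<Gamma>. a \<noteq> b"
      using \<open>card (involutions \<Gamma>) > 3\<close> card_le_Suc0_iff_eq[of "involutions \<Gamma>"]
        card.infinite[of "involutions \<Gamma>"] by fastforce
    then show ?thesis
      using finprod_carrier_eq_one[OF \<open>finite (carrier \<Gamma>)\<close>] by blast
  qed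
  ultimately obtain A where
    "\<forall>i < length ns. card (A i) = ns ! i \<and> finprod \<Gamma> (\<lambda>y. y) (A i) = \<one>\<^bsub>\<Gamma>\<^esub>"
    "disjoint_family_on A {..<length ns}" "(\<Union>i<length ns. A i) = carrier \<Gamma>"
    using exists_partition_product_one[OF \<open>finite (carrier \<Gamma>)\<close> _ ks _ ord] unfolding ns by blast
  then show ?thesis
    using distance_magic_if_partition_product_one[OF \<open>finite (carrier \<Gamma>)\<close> one
        \<open>complete_multipartite ns G\<close>] by blast
qed

end
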